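(* Let $t \geq 1$ be an even integer. Then, as $n\to\infty$, \[ \mathrm{rex}(n, K_{2,2t+1}) \geq \left( \sqrt{t/20} - o(1) \right) n^{3/2}. \]
   Context: All graphs are finite and simple. For a graph $F$, $\mathrm{rex}(n,F)$ denotes the maximum number of edges in an $n$-vertex graph that is regular and contains no subgraph isomorphic to $F$. $K_{a,b}$ is the complete bipartite graph with parts of sizes $a$ and $b$. *)

theory Defs
  imports
    Complex_Main
    "HOL-Library.Landau_Symbols"
    "Graph_Theory.Graph_Theory"
begin

text \<open>
  A finite simple graph is a digraph \<open>G\<close> with \<^term>\<open>pair_graph G\<close>: finite, loop-free and
  symmetric. Each undirected edge is a pair of opposite arcs in \<^term>\<open>parcs G\<close>.
\<close>

definition edge_set :: "'a pair_pre_digraph \<Rightarrow> 'a set set" where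
  "edge_set G = {{u, v} | u v. (u, v) \<in> parcs G}"

text \<open>In a symmetric digraph the out-degree is the number of neighbours.\<close>

definition regular_graph :: "'a pair_pre_digraph \<Rightarrow> bool" where
  "regular_graph G \<longleftrightarrow> pair_graph G \<and> (\<exists>d. \<forall>v \<in> pverts G. out_degree (with_proj G) v = d)"

text \<open>Subgraphs need not be induced.\<close>

definition contains_graph :: "'a pair_pre_digraph \<Rightarrow> 'b pair_pre_digraph \<Rightarrow> bool" where
  "contains_graph G F \<longleftrightarrow>
     (\<exists>H :: 'a pair_pre_digraph. pair_graph H \<and> subgraph (with_proj H) (with_proj G)
        \<and> digraph_iso (with_proj H) (with_proj F))"

text \<open>
  Every finite graph is isomorphic to one whose vertices are natural numbers, so fixing the vertex
  type is harmless. The maximum is over a finite set, which is nonempty if \<open>F\<close> has an edge;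
  see the lemmas below.
\<close>

definition rex_counts :: "nat \<Rightarrow> 'b pair_pre_digraph \<Rightarrow> nat set" where
  "rex_counts n F = {card (edge_set G) | G :: nat pair_pre_digraph.
     regular_graph G \<and> card (pverts G) = n \<and> \<not> contains_graph G F}"

definition rex :: "nat \<Rightarrow> 'b pair_pre_digraph \<Rightarrow> nat" where
  "rex n F = Max (rex_counts n F)"

definition complete_bipartite :: "nat \<Rightarrow> nat \<Rightarrow> (nat + nat) pair_pre_digraph" where
  "complete_bipartite a b =
     (let A = Inl ` {..<a}; B = Inr ` {..<b}
      in \<lparr> pverts = A \<union> B, parcs = A \<times> B \<union> B \<times> A \<rparr>)"

lemma complete_bipartite_digraph_complete_bipartite:
  "complete_bipartite_digraph a b (with_proj (complete_bipartite a b))"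
  unfolding complete_bipartite_digraph_pair_def
proof (intro conjI exI)
  let ?A = "Inl ` {..<a} :: (nat + nat) set" and ?B = "Inr ` {..<b} :: (nat + nat) set"
  show "finite (pverts (complete_bipartite a b))"
    and "pverts (complete_bipartite a b) = ?A \<union> ?B"
    and "parcs (complete_bipartite a b) = ?A \<times> ?B \<union> ?B \<times> ?A"
    by (simp_all add: complete_bipartite_def Let_def)
  show "?A \<inter> ?B = {}" "card ?A = a" "card ?B = b"
    by (auto simp: card_image)
qed

lemma finite_rex_counts: "finite (rex_counts n F)"
proof (rule finite_subset)
  show "rex_counts n F \<subseteq> {..2 ^ n}"
  proof
    fix m assume "m \<in> rex_counts n F"
    then obtain G :: "nat pair_pre_digraph"
      where m: "m = card (edge_set G)" and G: "pair_graph G" and n: "card (pverts G) = n"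
      by (auto simp: rex_counts_def regular_graph_def)
    interpret pair_graph G by (fact G)
    have "edge_set G \<subseteq> Pow (pverts G)"
      by (auto simp: edge_set_def dest: arc_fst_in_verts arc_snd_in_verts)
    then have "card (edge_set G) \<le> card (Pow (pverts G))"
      by (intro card_mono) auto
    then show "m \<in> {..2 ^ n}"
      by (simp add: m n card_Pow)
  qed
qed simp

lemma rex_counts_nonempty:
  assumes "parcs F \<noteq> {}"
  shows "rex_counts n F \<noteq> {}"
proof -
  define G :: "nat pair_pre_digraph" where "G = \<lparr> pverts = {..<n}, parcs = {} \<rparr>"
  have "pair_graph G"
    by unfold_locales (auto simp: G_def symmetric_def sym_def)
  then have "regular_graph G"
    by (auto simp: regular_graph_def out_degree_def out_arcs_def G_def)
  moreover have "\<not> contains_graph G F"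
  proof
    assume "contains_graph G F"
    then obtain H :: "nat pair_pre_digraph"
      where "subgraph (with_proj H) (with_proj G)" "digraph_iso (with_proj H) (with_proj F)"
      by (auto simp: contains_graph_def)
    then have "parcs H = {}" "parcs F = {}"
      by (auto simp: subgraph_def G_def digraph_iso_def app_iso_def with_proj_def)
    with assms show False by simp
  qed
  ultimately show ?thesis
    by (auto simp: rex_counts_def G_def intro!: exI[of _ G])
qed

end

theory Submission
  imports Defs "HOL-Number_Theory.Number_Theory" "HOL-Real_Asymp.Real_Asymp"
begin

text \<open>
  Write \<open>t = 2s\<close>. The graph is the Cayley graph of \<open>\<int>/n\<close> with connection set \<open>B \<union> -B\<close>,
  where \<open>B \<subseteq> [h, 3h)\<close>, \<open>h = n div 12\<close>, is a translate of \<open>{a div s | a \<in> A}\<close> for Ruzsa's Sidon set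
  \<open>A \<subseteq> [0, p(p - 1))\<close> of size \<open>p - 1\<close>. Rounding turns a prescribed difference or sum of elements of
  \<open>B\<close> into at most \<open>2s - 1\<close> possible ones in \<open>A\<close>, each attained at most once (differences) or twice
  (sums). The interval is chosen so that differences, sums and negated sums never collide
  modulo \<open>n\<close>; hence two vertices have at most \<open>2(2s - 1) \<le> 2t\<close> common neighbours.

  The prime has to satisfy \<open>p\<^sup>2 \<le> th\<close> while \<open>p\<^sup>2\<close> is at least about \<open>tn / 20\<close>;
  Chebyshev's elementary estimates give a prime in \<open>(24m, 30m]\<close> for large \<open>m\<close>, which suffices, so
  that \<open>\<epsilon> = 0\<close> works.
\<close>

section \<open>Primes between \<open>24m\<close> and \<open>30m\<close>\<close>

lemma ln_fact_Suc: "ln (fact (Suc n) :: real) = ln (fact n) + ln (real (Suc n))"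
  unfolding fact_Suc by (subst ln_mult_pos) auto

text \<open>Passing from n to n + 1 raises \<open>n div d\<close> by one exactly for the divisors d
  of n + 1, and their \<open>mangoldt\<close> values add up to ln(n + 1). The common range up to
  \<open>N\<close> lets several factorials be combined term by term.\<close>

lemma ln_fact_mangoldt:
  assumes "n \<le> N"
  shows "ln (fact n) = (\<Sum>d=1..N. mangoldt d * real (n div d))"
  using assms
proof (induction n)
  case 0
  then show ?case by simp
next
  case (Suc n)
  have div: "real (Suc n div d) = real (n div d) + (if d dvd Suc n then 1 else 0)" for d
    by (simp add: div_Suc dvd_eq_mod_eq_0)
  have "{d. d dvd Suc n} \<subseteq> {1..N}"
  proof
    fix d assume "d \<in> {d. d dvd Suc n}"
    then show "d \<in> {1..N}"
      using Suc.prems dvd_imp_le[of d "Suc n"] dvd_pos_nat[of "Suc n" d] by simp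
  qed
  then have "(\<Sum>d=1..N. mangoldt d * (if d dvd Suc n then 1 else 0)) = (\<Sum>d | d dvd Suc n. mangoldt d :: real)"
    by (intro sum.mono_neutral_cong_right) auto
  also have "\<dots> = ln (real (Suc n))"
    using mangoldt_sum[of "Suc n", where ?'a = real] by simp
  finally have "(\<Sum>d=1..N. mangoldt d * real (Suc n div d)) = ln (fact n) + ln (real (Suc n))"
    using Suc by (simp only: div distrib_left sum.distrib)
  also have "\<dots> = ln (fact (Suc n))"
    by (rule ln_fact_Suc [symmetric])
  finally show ?case by simp
qed

lemma ln_fact_lower:
  assumes "n \<ge> 1"
  shows "real n * ln n - n \<le> ln (fact n)"
  using assms
proof (induction n rule: nat_induct_at_least)
  case base
  then show ?case by simp
next
  case (Suc n)
  have "ln (1 + 1 / real n) \<le> 1 / real n"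
    by (intro ln_add_one_self_le_self) simp
  moreover have "ln (1 + 1 / real n) = ln (Suc n) - ln n"
  proof -
    have "1 + 1 / real n = Suc n / n"
      using Suc.hyps by (simp add: field_simps)
    then show ?thesis
      using Suc.hyps by (simp add: ln_divide_pos)
  qed
  ultimately have "real n * (ln (Suc n) - ln n) \<le> real n * (1 / n)"
    by (intro mult_left_mono) simp_all
  also have "\<dots> = 1"
    using Suc.hyps by simp
  finally have "real n * (ln (Suc n) - ln n) \<le> 1" .
  with Suc.IH show ?case
    unfolding ln_fact_Suc by (simp add: algebra_simps)
qed

lemma ln_fact_upper:
  assumes "n \<ge> 1"
  shows "ln (fact n) \<le> real n * ln n - n + ln n + 1"
  using assms
proof (induction n rule: nat_induct_at_least)
  case base
  then show ?case by simp
next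
  case (Suc n)
  have "ln (real n / Suc n) \<le> real n / Suc n - 1"
    using Suc.hyps by (intro ln_le_minus_one) simp
  also have "\<dots> = - 1 / Suc n"
    by (simp add: field_simps)
  finally have "ln (real n) - ln (Suc n) \<le> - 1 / Suc n"
    using Suc.hyps by (subst (asm) ln_div) auto
  then have "real (Suc n) * (ln (real n) - ln (Suc n)) \<le> - 1"
    by (simp add: field_simps)
  with Suc.IH show ?case
    unfolding ln_fact_Suc by (simp add: algebra_simps)
qed

section \<open>Chebyshev's bounds on psi and the primes they yield\<close>

definition chebyshev_psi :: "nat \<Rightarrow> real" where
  "chebyshev_psi n = (\<Sum>d=1..n. mangoldt d)"

text \<open>Chebyshev's choice: \<open>30 + 1 = 15 + 10 + 6\<close> cancels the \<open>m ln m\<close> terms in Stirling's formula,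
  and the resulting weights of the von Mangoldt function are 0 or 1.\<close>

definition chebyshev_quot :: "nat \<Rightarrow> real" where
  "chebyshev_quot m =
     ln (fact (30 * m)) + ln (fact m) - ln (fact (15 * m)) - ln (fact (10 * m)) - ln (fact (6 * m))"

text \<open>This is 30 ln 30 - 15 ln 15 - 10 ln 10 - 6 ln 6, the coefficient of m that survives in
  \<open>chebyshev_quot m\<close> after inserting Stirling's formula.\<close>

definition chebyshev_const :: real where
  "chebyshev_const = 14 * ln 2 + 9 * ln 3 + 5 * ln 5"

lemma chebyshev_const_pos: "chebyshev_const > 0"
proof -
  have "ln 2 > (0::real)" "ln 3 > (0::real)" "ln 5 > (0::real)"
    by simp_all
  then show ?thesis
    unfolding chebyshev_const_def by linarith
qed

lemma ln_smooth_mult: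
  assumes "m \<ge> (1::nat)"
  shows "ln (real (30 * m)) = ln 2 + ln 3 + ln 5 + ln m"
    and "ln (real (15 * m)) = ln 3 + ln 5 + ln m"
    and "ln (real (10 * m)) = ln 2 + ln 5 + ln m"
    and "ln (real (6 * m)) = ln 2 + ln 3 + ln m"
proof -
  have "ln (30::real) = ln (2 * 3 * 5)" "ln (15::real) = ln (3 * 5)" "ln (10::real) = ln (2 * 5)"
    "ln (6::real) = ln (2 * 3)"
    by simp_all
  then have "ln (30::real) = ln 2 + ln 3 + ln 5" "ln (15::real) = ln 3 + ln 5"
    "ln (10::real) = ln 2 + ln 5" "ln (6::real) = ln 2 + ln 3"
    by (simp_all only: ln_mult_pos zero_less_numeral mult_pos_pos)
  with assms show "ln (real (30 * m)) = ln 2 + ln 3 + ln 5 + ln m"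
    and "ln (real (15 * m)) = ln 3 + ln 5 + ln m"
    and "ln (real (10 * m)) = ln 2 + ln 5 + ln m"
    and "ln (real (6 * m)) = ln 2 + ln 3 + ln m"
    by (simp_all add: ln_mult_pos)
qed

lemma chebyshev_quot_upper:
  assumes "m \<ge> 1"
  shows "chebyshev_quot m \<le> chebyshev_const * m + ln (real (30 * m)) + ln (real m) + 2"
  using assms ln_fact_upper[of "30 * m"] ln_fact_upper[of m] ln_fact_lower[of "15 * m"]
    ln_fact_lower[of "10 * m"] ln_fact_lower[of "6 * m"]
  unfolding chebyshev_quot_def chebyshev_const_def ln_smooth_mult[OF assms]
  by (simp add: algebra_simps)

lemma chebyshev_quot_lower:
  assumes "m \<ge> 1"
  shows "chebyshev_quot m \<ge> chebyshev_const * m - ln (real (15 * m)) - ln (real (10 * m)) - ln (real (6 * m)) - 3"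
  using assms ln_fact_lower[of "30 * m"] ln_fact_lower[of m] ln_fact_upper[of "15 * m"]
    ln_fact_upper[of "10 * m"] ln_fact_upper[of "6 * m"]
  unfolding chebyshev_quot_def chebyshev_const_def ln_smooth_mult[OF assms]
  by (simp add: algebra_simps)

lemma chebyshev_weight:
  fixes k :: nat
  shows "k div 2 + k div 3 + k div 5 \<le> k + k div 30"
    and "k + k div 30 \<le> k div 2 + k div 3 + k div 5 + 1"
    and "1 \<le> k \<Longrightarrow> k < 6 \<Longrightarrow> k + k div 30 = k div 2 + k div 3 + k div 5 + 1"
proof -
  show "k div 2 + k div 3 + k div 5 \<le> k + k div 30"
    and "k + k div 30 \<le> k div 2 + k div 3 + k div 5 + 1"
    by linarith+
  assume "1 \<le> k" "k < 6"
  then have "k \<in> {1, 2, 3, 4, 5}" by auto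
  then show "k + k div 30 = k div 2 + k div 3 + k div 5 + 1" by auto
qed

lemma chebyshev_psi_diff:
  assumes "M \<le> N"
  shows "chebyshev_psi N - chebyshev_psi M = (\<Sum>d\<in>{M<..N}. mangoldt d)"
proof -
  have "{1..N} = {1..M} \<union> {M<..N}"
    using assms by auto
  moreover have "(\<Sum>d\<in>{1..M} \<union> {M<..N}. mangoldt d :: real)
    = (\<Sum>d=1..M. mangoldt d) + (\<Sum>d\<in>{M<..N}. mangoldt d)"
    by (intro sum.union_disjoint) auto
  ultimately show ?thesis
    by (simp add: chebyshev_psi_def)
qed

text \<open>With k = \<open>30 * m div d\<close>, nested floors turn the weight of
  \<open>mangoldt d\<close> into the expression of \<open>chebyshev_weight\<close>. It is 0 or 1,
  and it equals 1 when 1 <= k < 6, which covers all d in (5m, 30m].\<close>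

lemma chebyshev_quot_psi:
  shows "chebyshev_quot m \<le> chebyshev_psi (30 * m)"
    and "chebyshev_psi (30 * m) - chebyshev_psi (5 * m) \<le> chebyshev_quot m"
proof -
  define E :: "nat \<Rightarrow> real" where "E d = real (30 * m div d) + real (m div d)
    - real (15 * m div d) - real (10 * m div d) - real (6 * m div d)" for d
  have quot: "chebyshev_quot m = (\<Sum>d=1..30*m. mangoldt d * E d)"
    unfolding chebyshev_quot_def E_def
    by (subst (1 2 3 4 5) ln_fact_mangoldt[where N = "30 * m"])
       (simp_all add: sum.distrib sum_subtractf algebra_simps)
  have E: "E d = real k + real (k div 30) - real (k div 2) - real (k div 3) - real (k div 5)"
    if "k = 30 * m div d" for d k
  proof -
    have "k div 30 = m div d" "k div 2 = 15 * m div d" "k div 3 = 10 * m div d" "k div 5 = 6 * m div d"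
      unfolding that by (simp_all add: div_mult2_eq[symmetric] mult.commute[of d])
    then show ?thesis
      by (simp add: E_def that)
  qed
  have E_le: "E d \<le> 1" and E_ge: "E d \<ge> 0" for d
    using chebyshev_weight(1,2)[of "30 * m div d"] by (simp_all add: E[OF refl])
  have E_eq: "E d = 1" if "d \<in> {5*m<..30*m}" for d
  proof -
    have "30 * m div d \<ge> 1"
      using that by (simp add: Suc_le_eq div_greater_zero_iff)
    moreover have "30 * m div d < 6"
      using that by (intro less_mult_imp_div_less) auto
    ultimately show ?thesis
      using chebyshev_weight(3)[of "30 * m div d"] by (simp add: E[OF refl])
  qed
  show "chebyshev_quot m \<le> chebyshev_psi (30 * m)"
    unfolding quot chebyshev_psi_def
    by (intro sum_mono mult_left_le E_le mangoldt_nonneg)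
  have "chebyshev_psi (30 * m) - chebyshev_psi (5 * m) = (\<Sum>d\<in>{5*m<..30*m}. mangoldt d)"
    by (intro chebyshev_psi_diff) simp
  also have "\<dots> = (\<Sum>d\<in>{5*m<..30*m}. mangoldt d * E d)"
    by (intro sum.cong) (simp_all add: E_eq)
  also have "\<dots> \<le> chebyshev_quot m"
    unfolding quot by (intro sum_mono2) (auto intro: mult_nonneg_nonneg mangoldt_nonneg E_ge)
  finally show "chebyshev_psi (30 * m) - chebyshev_psi (5 * m) \<le> chebyshev_quot m" .
qed

lemma chebyshev_psi_mono: "m \<le> n \<Longrightarrow> chebyshev_psi m \<le> chebyshev_psi n"
  unfolding chebyshev_psi_def by (intro sum_mono2) (auto intro: mangoldt_nonneg)

text \<open>Each interval (5m, 30m] has length 25m and contributes at most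
  \<open>chebyshev_const * m\<close> plus logarithmic terms. Iterating on 5m therefore gives every
  slope above \<open>chebyshev_const / 25\<close>.\<close>

lemma chebyshev_psi_linear_bound:
  assumes "a > chebyshev_const / 25"
  shows "\<exists>K. \<forall>n. chebyshev_psi n \<le> a * n + K"
proof -
  have a: "a > 0" "25 * a - chebyshev_const > 0"
    using assms chebyshev_const_pos by auto
  define D where "D = 25 * a - chebyshev_const"
  have "D > 0" using a by (simp add: D_def)
  \<comment> \<open>The slack \<open>D * m\<close> pays for the logarithms and also for
    \<open>30 * a\<close>, the cost of rounding n up to a multiple of 30 in the induction
    below.\<close>
  then have "\<forall>\<^sub>F m in sequentially. ln (30 * real m) + ln (real m) + 2 + 30 * a \<le> D * real m"
    by real_asymp
  then obtain M where M: "\<And>m. m \<ge> M \<Longrightarrow> ln (30 * real m) + ln (real m) + 2 + 30 * a \<le> D * real m"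
    by (auto simp: eventually_sequentially)
  have quot: "chebyshev_quot m \<le> 25 * a * m - 30 * a" if "m \<ge> max 1 M" for m
    using M[of m] chebyshev_quot_upper[of m] that by (simp add: D_def algebra_simps)
  define K where "K = chebyshev_psi (30 * max 1 M)"
  have "chebyshev_psi n \<le> a * n + K" for n
  proof (induction n rule: less_induct)
    case (less n)
    show ?case
    proof (cases "n < 30 * max 1 M")
      case True
      then have "chebyshev_psi n \<le> K"
        unfolding K_def by (intro chebyshev_psi_mono) simp
      moreover have "a * n \<ge> 0" using a by simp
      ultimately show ?thesis by linarith
    next
      case False
      define m where "m = n div 30 + 1"
      have m: "n \<le> 30 * m" "30 * m \<le> n + 30" "5 * m < n" "m \<ge> max 1 M"
        using False unfolding m_def by (auto simp: max_def split: if_splits)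
      have "chebyshev_psi n \<le> chebyshev_psi (30 * m)"
        using m by (intro chebyshev_psi_mono)
      also have "\<dots> \<le> chebyshev_psi (5 * m) + chebyshev_quot m"
        using chebyshev_quot_psi(2)[of m] by simp
      also have "\<dots> \<le> (a * real (5 * m) + K) + (25 * a * m - 30 * a)"
        using less.IH[OF m(3)] quot[OF m(4)] by linarith
      also have "\<dots> = a * (real (30 * m) - 30) + K"
        by (simp add: algebra_simps)
      also have "\<dots> \<le> a * n + K"
        using a m(2) by (intro add_right_mono mult_left_mono) linarith+
      finally show ?thesis .
    qed
  qed
  then show ?thesis by blast
qed

text \<open>Only powers p^k with k >= 2 can contribute, so p <= sqrt N and k <= log 2 N, and each
  contributes at most ln N. The total is o(N), which will contradict linear growth of psi across the
  interval.\<close>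

lemma mangoldt_sum_without_primes:
  assumes "M \<ge> 1" "N \<ge> 1" and no_prime: "\<And>p. prime p \<Longrightarrow> M < p \<Longrightarrow> p \<le> N \<Longrightarrow> False"
  shows "chebyshev_psi N - chebyshev_psi M \<le> (sqrt N + 1) * (log 2 N + 1) * ln N"
proof -
  define I where "I = {..nat \<lfloor>sqrt N\<rfloor>} \<times> {..nat \<lfloor>log 2 N\<rfloor>}"
  define S where "S = {d \<in> {M<..N}. primepow d}"
  have "d \<in> (\<lambda>(p, k). p ^ k) ` I" if "d \<in> S" for d
  proof -
    from that have "primepow d" and d: "M < d" "d \<le> N"
      by (auto simp: S_def)
    then obtain p k where p: "prime p" "k > 0" "d = p ^ k"
      by (auto simp: primepow_def)
    have "k \<noteq> 1"
      using no_prime[of p] p d by auto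
    then have "k \<ge> 2" using p by simp
    have "p ^ 2 \<le> p ^ k"
      using \<open>k \<ge> 2\<close> prime_gt_0_nat[OF p(1)] by (intro power_increasing) auto
    then have "real (p ^ 2) \<le> real N"
      using p d by linarith
    then have "real p \<le> sqrt N"
      by (intro real_le_rsqrt) simp
    then have "p \<le> nat \<lfloor>sqrt N\<rfloor>"
      by (simp add: le_nat_floor)
    moreover have "2 ^ k \<le> p ^ k"
      using prime_ge_2_nat[OF p(1)] by (intro power_mono) auto
    then have "real (2 ^ k) \<le> real N"
      using p d by linarith
    then have "real k \<le> log 2 N"
      using assms by (simp add: le_log_iff powr_realpow)
    then have "k \<le> nat \<lfloor>log 2 N\<rfloor>"
      by (simp add: le_nat_floor)
    ultimately show ?thesis
      using p by (auto simp: I_def)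
  qed
  then have "card S \<le> card I"
    by (intro surj_card_le) (auto simp: I_def)
  then have "real (card S) \<le> real (card I)" by simp
  also have "\<dots> = (real (nat \<lfloor>sqrt N\<rfloor>) + 1) * (real (nat \<lfloor>log 2 N\<rfloor>) + 1)"
    by (simp add: I_def card_cartesian_product algebra_simps)
  also have "\<dots> \<le> (sqrt N + 1) * (log 2 N + 1)"
  proof -
    have "log 2 (real N) \<ge> 0" using assms by simp
    then show ?thesis
      by (intro mult_mono add_right_mono) auto
  qed
  finally have card: "real (card S) \<le> (sqrt N + 1) * (log 2 N + 1)" .
  have "chebyshev_psi N - chebyshev_psi M \<le> (\<Sum>d\<in>S. mangoldt d)"
  proof (cases "M \<le> N")
    case True
    then have "chebyshev_psi N - chebyshev_psi M = (\<Sum>d\<in>{M<..N}. mangoldt d)"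
      by (rule chebyshev_psi_diff)
    also have "\<dots> = (\<Sum>d\<in>S. mangoldt d)"
      by (intro sum.mono_neutral_right) (auto simp: S_def mangoldt_def)
    finally show ?thesis by simp
  next
    case False
    then have "chebyshev_psi N \<le> chebyshev_psi M"
      by (intro chebyshev_psi_mono) simp
    moreover have "(\<Sum>d\<in>S. mangoldt d :: real) \<ge> 0"
      by (intro sum_nonneg mangoldt_nonneg)
    ultimately show ?thesis by linarith
  qed
  also have "\<dots> \<le> (\<Sum>d\<in>S. ln N)"
  proof (intro sum_mono)
    fix d assume "d \<in> S"
    then have "0 < d" "d \<le> N" by (auto simp: S_def)
    then have "mangoldt d \<le> ln (real d)" "ln (real d) \<le> ln (real N)"
      by (auto intro: mangoldt_le)
    then show "mangoldt d \<le> ln (real N)" by linarith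
  qed
  also have "\<dots> = card S * ln N" by simp
  also have "\<dots> \<le> (sqrt N + 1) * (log 2 N + 1) * ln N"
    using card assms by (intro mult_right_mono) auto
  finally show ?thesis .
qed

lemma eventually_prime_between_24_30:
  "\<forall>\<^sub>F m in sequentially. \<exists>p. prime p \<and> 24 * m < p \<and> p \<le> (30 * m :: nat)"
proof -
  define B where "B = chebyshev_const"
  have B: "B > 0" by (simp add: B_def chebyshev_const_pos)
  \<comment> \<open>This lies between B/25, where the upper bound on psi starts to hold, and B/24.
    Hence 24a < B, and psi(30m) - psi(24m) is at least (B/49)m up to logarithmic terms.\<close>
  define a where "a = 2 * B / 49"
  have "a > chebyshev_const / 25"
    using B by (simp add: a_def B_def)
  then obtain K where K: "\<And>n. chebyshev_psi n \<le> a * n + K"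
    using chebyshev_psi_linear_bound by blast
  have "\<forall>\<^sub>F m in sequentially. (sqrt (30 * real m) + 1) * (log 2 (30 * real m) + 1) * ln (30 * real m)
    < B / 49 * real m - ln (15 * real m) - ln (10 * real m) - ln (6 * real m) - 3 - K"
    using B by real_asymp
  moreover have "\<forall>\<^sub>F m in sequentially. m \<ge> (1::nat)"
    by (rule eventually_ge_at_top)
  ultimately show ?thesis
  proof eventually_elim
    case (elim m)
    show ?case
    proof (rule ccontr)
      assume "\<not> ?thesis"
      then have "chebyshev_psi (30 * m) - chebyshev_psi (24 * m)
        \<le> (sqrt (real (30 * m)) + 1) * (log 2 (real (30 * m)) + 1) * ln (real (30 * m))"
        using elim(2) by (intro mangoldt_sum_without_primes) auto
      moreover have "chebyshev_psi (30 * m)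
        \<ge> B * m - ln (real (15 * m)) - ln (real (10 * m)) - ln (real (6 * m)) - 3"
        using chebyshev_quot_lower[OF elim(2)] chebyshev_quot_psi(1)[of m] by (simp add: B_def)
      moreover have "chebyshev_psi (24 * m) \<le> 48 * B / 49 * m + K"
        using K[of "24 * m"] by (simp add: a_def)
      ultimately show False
        using elim(1) by (simp add: algebra_simps)
    qed
  qed
qed

section \<open>Sidon sets\<close>

definition sidon :: "nat set \<Rightarrow> bool" where
  "sidon A \<longleftrightarrow> (\<forall>a\<in>A. \<forall>b\<in>A. \<forall>c\<in>A. \<forall>d\<in>A. a + b = c + d \<longrightarrow> a = c \<and> b = d \<or> a = d \<and> b = c)"

lemma sidonD:
  "\<lbrakk>sidon A; a \<in> A; b \<in> A; c \<in> A; d \<in> A; a + b = c + d\<rbrakk> \<Longrightarrow> a = c \<and> b = d \<or> a = d \<and> b = c"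
  unfolding sidon_def by blast

lemma sidon_subset: "sidon A \<Longrightarrow> B \<subseteq> A \<Longrightarrow> sidon B"
  unfolding sidon_def by blast

text \<open>Modulo p, \<open>a\<close> is a root of (X - c)(X - d), because this polynomial agrees
  with (X - a)(X - b).\<close>

lemma cong_sum_prod_imp_cong:
  fixes p :: nat and a b c d :: int
  assumes "prime p" "[a + b = c + d] (mod p)" "[a * b = c * d] (mod p)"
  shows "[a = c] (mod p) \<or> [a = d] (mod p)"
proof -
  have "int p dvd (a + b) - (c + d)" "int p dvd a * b - c * d"
    using assms(2,3) by (simp_all only: cong_iff_dvd_diff)
  then have "int p dvd a * ((a + b) - (c + d)) - (a * b - c * d)"
    by (rule dvd_diff[OF dvd_mult])
  also have "a * ((a + b) - (c + d)) - (a * b - c * d) = (a - c) * (a - d)"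
    by (simp add: algebra_simps)
  finally show ?thesis
    using assms(1) by (simp add: prime_dvd_mult_iff cong_iff_dvd_diff)
qed

text \<open>Ruzsa's construction: the graph of the discrete logarithm in \<open>\<int>/(p-1) \<times> \<int>/p \<cong> \<int>/p(p-1)\<close>.\<close>

lemma exists_sidon:
  assumes "prime p"
  shows "\<exists>A. A \<subseteq> {..<p * (p - 1)} \<and> card A = p - 1 \<and> sidon A"
proof -
  have p: "p \<ge> 2" using assms by (rule prime_ge_2_nat)
  obtain g where "residue_primroot p g"
    using assms prime_primitive_root_exists[of p] p by (auto simp: residue_primroot_def totient_prime)
  then have g: "coprime p g" "ord p g = p - 1"
    using assms by (auto simp: residue_primroot_def totient_prime)
  have "coprime (p - 1) p"
    using p by (intro coprime_diff_one_left_nat) simp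
  \<comment> \<open>The Chinese remainder theorem encodes the pair (i, g^i) as one number
    \<open>f i\<close>.\<close>
  then have "\<exists>x. x < (p - 1) * p \<and> [x = i] (mod (p - 1)) \<and> [x = g ^ i] (mod p)" for i
    using binary_chinese_remainder_unique_nat[of "p - 1" p i "g ^ i"] p by auto
  then obtain f where f: "\<And>i. f i < (p - 1) * p" "\<And>i. [f i = i] (mod (p - 1))"
    "\<And>i. [f i = g ^ i] (mod p)"
    by metis
  have f_eqI: "f i = f k" if "[f i = f k] (mod p)" "i < p - 1" "k < p - 1" for i k
  proof -
    have "[g ^ i = g ^ k] (mod p)"
      using that(1) f(3) by (meson cong_sym cong_trans)
    then have "[i = k] (mod (p - 1))"
      using order_divides_expdiff[OF g(1)] g(2) by simp
    then show ?thesis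
      using that by (simp add: Cong.cong_def)
  qed
  have inj: "inj_on f {..<p - 1}"
  proof (rule inj_onI)
    fix i k assume "i \<in> {..<p - 1}" "k \<in> {..<p - 1}" "f i = f k"
    then show "i = k"
      using f(2)[of i] f(2)[of k] by (simp add: Cong.cong_def)
  qed
  have "sidon (f ` {..<p - 1})"
    unfolding sidon_def
  proof (intro ballI impI, elim imageE)
    fix a b c d i j k l
    assume "i \<in> {..<p - 1}" "j \<in> {..<p - 1}" "k \<in> {..<p - 1}" "l \<in> {..<p - 1}"
      and abcd: "a = f i" "b = f j" "c = f k" "d = f l" and "a + b = c + d"
    then have less: "i < p - 1" "j < p - 1" "k < p - 1" "l < p - 1"
      and sum: "f i + f j = f k + f l"
      by simp_all
    \<comment> \<open>The single integer equation is read twice: modulo p - 1 it equates exponent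
      sums, hence products of powers of g modulo p; modulo p it equates the sums themselves.\<close>
    have "[i + j = f i + f j] (mod (p - 1))" "[f k + f l = k + l] (mod (p - 1))"
      by (intro cong_add f(2) cong_sym[OF f(2)])+
    then have "[i + j = k + l] (mod (p - 1))"
      unfolding sum by (rule cong_trans)
    then have "[g ^ (i + j) = g ^ (k + l)] (mod p)"
      using order_divides_expdiff[OF g(1)] g(2) by simp
    then have "[f i * f j = f k * f l] (mod p)"
      using cong_mult[OF f(3)[of i] f(3)[of j]] cong_mult[OF f(3)[of k] f(3)[of l]]
      unfolding power_add by (meson cong_sym cong_trans)
    then have "[int (f i) * int (f j) = int (f k) * int (f l)] (mod int p)"
      by (simp flip: of_nat_mult add: cong_int_iff)
    moreover have "[int (f i) + int (f j) = int (f k) + int (f l)] (mod int p)"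
      using sum by (simp flip: of_nat_add)
    ultimately have "[int (f i) = int (f k)] (mod int p) \<or> [int (f i) = int (f l)] (mod int p)"
      using assms by (intro cong_sum_prod_imp_cong)
    then have "f i = f k \<or> f i = f l"
      using f_eqI less by (auto simp: cong_int_iff)
    then show "a = c \<and> b = d \<or> a = d \<and> b = c"
      using sum abcd by auto
  qed
  moreover have "f ` {..<p - 1} \<subseteq> {..<p * (p - 1)}"
    using f(1) by (auto simp: mult.commute)
  ultimately show ?thesis
    using card_image[OF inj] by auto
qed

text \<open>Two elements with the same quotient differ by less than \<open>s\<close>, and each such
  difference occurs at most once.\<close>

lemma sidon_div_inj_subset:
  assumes "finite A" "sidon A" "s > 0"
  shows "\<exists>A' \<subseteq> A. inj_on (\<lambda>a. a div s) A' \<and> card A \<le> card A' + (s - 1)"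
proof -
  \<comment> \<open>\<open>R\<close> holds the elements that are not least in their block of equal
    quotients. Removing it keeps one element per block, and mapping a to its difference from a
    smaller block mate embeds \<open>R\<close> into {1..s - 1}.\<close>
  define R where "R = {a \<in> A. \<exists>b \<in> A. b < a \<and> a div s = b div s}"
  have "\<forall>a \<in> R. \<exists>b. b \<in> A \<and> b < a \<and> a div s = b div s"
    by (auto simp: R_def)
  then obtain h where h: "\<And>a. a \<in> R \<Longrightarrow> h a \<in> A \<and> h a < a \<and> a div s = h a div s"
    by metis
  have R: "R \<subseteq> A" by (auto simp: R_def)
  have "inj_on (\<lambda>a. a - h a) R"
  proof (rule inj_onI)
    fix a b assume ab: "a \<in> R" "b \<in> R" and eq: "a - h a = b - h b"
    then have "a + h b = b + h a"
      using h[of a] h[of b] by linarith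
    then have "a = b \<and> h b = h a \<or> a = h a \<and> h b = b"
      using ab h R by (intro sidonD[OF assms(2)]) auto
    moreover have "h a < a"
      using h ab by blast
    ultimately show "a = b"
      by linarith
  qed
  moreover have "(\<lambda>a. a - h a) ` R \<subseteq> {1..s - 1}"
  proof safe
    fix a assume "a \<in> R"
    from h[OF this] have lt: "h a < a" and dv: "a div s = h a div s" by auto
    have "a = s * (a div s) + a mod s"
      by simp
    moreover have "h a = s * (a div s) + h a mod s"
      unfolding dv by simp
    ultimately have "a - h a \<le> a mod s" by linarith
    also have "\<dots> < s" using assms by simp
    finally show "a - h a \<in> {1..s - 1}"
      using lt by auto
  qed
  ultimately have "card R \<le> card {1..s - 1}"
    by (intro card_inj_on_le) auto
  then have "card A \<le> card (A - R) + (s - 1)"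
    using R assms(1) by (simp add: card_Diff_subset finite_subset)
  moreover have "inj_on (\<lambda>a. a div s) (A - R)"
  proof (rule inj_onI)
    fix a b assume "a \<in> A - R" "b \<in> A - R" "a div s = b div s"
    then show "a = b"
      by (cases a b rule: linorder_cases) (auto simp: R_def)
  qed
  ultimately show ?thesis by blast
qed

section \<open>Counting differences and sums after rounding\<close>

lemma int_mod_le_pred: "s > 0 \<Longrightarrow> int (a mod s) \<le> int s - 1"
  using mod_less_divisor[of s a] by linarith

text \<open>If the quotients of a and c differ by \<gamma>, then a - c differs from s\<gamma> by
  less than s, leaving 2s - 1 values. The Sidon property recovers (a, c) from a - c, since \<gamma>
  nonzero rules out a = c.\<close>

lemma card_div_differences:
  fixes \<gamma> :: int
  assumes "sidon A" "finite A" "s > 0" "inj_on (\<lambda>a. a div s) A" "\<gamma> \<noteq> 0"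
  defines "B \<equiv> (\<lambda>a. int (a div s)) ` A"
  shows "card {b \<in> B. b - \<gamma> \<in> B} \<le> 2 * s - 1"
proof -
  define P where "P = {(a, c) \<in> A \<times> A. int (a div s) - int (c div s) = \<gamma>}"
  have "{b \<in> B. b - \<gamma> \<in> B} \<subseteq> (\<lambda>(a, c). int (a div s)) ` P"
    by (force simp: B_def P_def)
  moreover have fin: "finite P"
    using assms(2) by (auto simp: P_def intro: finite_subset[of _ "A \<times> A"])
  ultimately have "card {b \<in> B. b - \<gamma> \<in> B} \<le> card P"
    by (rule surj_card_le[rotated])
  also have "\<dots> \<le> card {s * \<gamma> - (s - 1)..s * \<gamma> + (s - 1)}"
  proof (rule card_inj_on_le)
    show "inj_on (\<lambda>(a, c). int a - int c) P"
    proof (rule inj_onI, clarify)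
      fix a c b d assume P: "(a, c) \<in> P" "(b, d) \<in> P" and "int a - int c = int b - int d"
      then have "a + d = b + c" by linarith
      then have "a = b \<and> d = c \<or> a = c \<and> d = b"
        using P by (intro sidonD[OF assms(1)]) (auto simp: P_def)
      then show "a = b \<and> c = d"
        using P assms(5) by (auto simp: P_def)
    qed
    show "(\<lambda>(a, c). int a - int c) ` P \<subseteq> {s * \<gamma> - (s - 1)..s * \<gamma> + (s - 1)}"
    proof (clarify)
      fix a c assume "(a, c) \<in> P"
      then have \<gamma>: "\<gamma> = int (a div s) - int (c div s)" by (simp add: P_def)
      have "int a = int s * int (a div s) + int (a mod s)" "int c = int s * int (c div s) + int (c mod s)"
        by (simp_all flip: of_nat_mult of_nat_add)
      then have "int a - int c = int s * \<gamma> + (int (a mod s) - int (c mod s))"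
        by (simp add: \<gamma> algebra_simps)
      moreover have "int (a mod s) \<le> int s - 1" "int (c mod s) \<le> int s - 1"
        using assms(3) by (simp_all only: int_mod_le_pred)
      ultimately show "int a - int c \<in> {s * \<gamma> - (s - 1)..s * \<gamma> + (s - 1)}"
        unfolding atLeastAtMost_iff by linarith
    qed
  qed simp
  also have "\<dots> = 2 * s - 1"
    using assms(3) by (simp add: nat_eq_iff)
  finally show ?thesis .
qed

lemma card_doubleton_le: "card {x, y} \<le> 2"
  by (cases "x = y") auto

text \<open>The two remainders add up to a number in [0, 2s - 2], leaving 2s - 1 values of a + c.
  Each determines the pair only up to order, hence the extra factor 2.\<close>

lemma card_div_sums:
  fixes \<gamma> :: int
  assumes "sidon A" "finite A" "s > 0"
  defines "B \<equiv> (\<lambda>a. int (a div s)) ` A"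
  shows "card {b \<in> B. \<gamma> - b \<in> B} \<le> 2 * (2 * s - 1)"
proof -
  define P where "P = {(a, c) \<in> A \<times> A. int (a div s) + int (c div s) = \<gamma>}"
  define I where "I = {s * \<gamma>..s * \<gamma> + (2 * s - 2)}"
  have "{b \<in> B. \<gamma> - b \<in> B} \<subseteq> (\<lambda>(a, c). int (a div s)) ` P"
    by (force simp: B_def P_def)
  moreover have fin: "finite P"
    using assms(2) by (auto simp: P_def intro: finite_subset[of _ "A \<times> A"])
  ultimately have "card {b \<in> B. \<gamma> - b \<in> B} \<le> card P"
    by (rule surj_card_le[rotated])
  also have "P \<subseteq> (\<Union>i\<in>I. {(a, c) \<in> P. int a + int c = i})"
  proof clarify
    fix a c assume ac: "(a, c) \<in> P"
    then have \<gamma>: "\<gamma> = int (a div s) + int (c div s)" by (simp add: P_def)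
    have "int a = int s * int (a div s) + int (a mod s)" "int c = int s * int (c div s) + int (c mod s)"
      by (simp_all flip: of_nat_mult of_nat_add)
    then have "int a + int c = int s * \<gamma> + (int (a mod s) + int (c mod s))"
      by (simp add: \<gamma> algebra_simps)
    moreover have "int (a mod s) \<le> int s - 1" "int (c mod s) \<le> int s - 1"
      using assms(3) by (simp_all only: int_mod_le_pred)
    ultimately have "int a + int c \<in> I"
      unfolding I_def atLeastAtMost_iff by linarith
    with ac show "(a, c) \<in> (\<Union>i\<in>I. {(a, c) \<in> P. int a + int c = i})"
      by auto
  qed
  then have "card P \<le> card (\<Union>i\<in>I. {(a, c) \<in> P. int a + int c = i})"
    using fin by (intro card_mono) (auto simp: I_def intro: finite_subset)
  also have "\<dots> \<le> (\<Sum>i\<in>I. card {(a, c) \<in> P. int a + int c = i})"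
    by (intro card_UN_le) (simp add: I_def)
  also have "\<dots> \<le> (\<Sum>i\<in>I. 2)"
  proof (rule sum_mono)
    fix i
    show "card {(a, c) \<in> P. int a + int c = i} \<le> 2"
    proof (cases "{(a, c) \<in> P. int a + int c = i} = {}")
      case False
      then obtain b d where bd: "(b, d) \<in> P" "int b + int d = i" by auto
      have "{(a, c) \<in> P. int a + int c = i} \<subseteq> {(b, d), (d, b)}"
      proof (rule subsetI)
        fix z assume "z \<in> {(a, c) \<in> P. int a + int c = i}"
        then obtain a c where z: "z = (a, c)" and ac: "(a, c) \<in> P" "int a + int c = i" by auto
        then have "a + c = b + d" using bd by linarith
        then have "a = b \<and> c = d \<or> a = d \<and> c = b"
          using ac bd by (intro sidonD[OF assms(1)]) (auto simp: P_def)
        with z show "z \<in> {(b, d), (d, b)}" by auto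
      qed
      then have "card {(a, c) \<in> P. int a + int c = i} \<le> card {(b, d), (d, b)}"
        by (intro card_mono) auto
      also have "\<dots> \<le> 2" by (rule card_doubleton_le)
      finally show ?thesis .
    next
      case True
      show ?thesis
        unfolding True by simp
    qed
  qed
  also have "\<dots> = 2 * (2 * s - 1)"
    using assms(3) by (simp add: I_def nat_eq_iff)
  finally show ?thesis .
qed

text \<open>Since \<open>B\<close> lies in \<open>[h, 3h)\<close>, differences of its elements have absolute value below \<open>2h\<close> and
  sums are at least \<open>2h\<close>, so for each \<open>\<gamma>\<close> only one of the two kinds of solutions occurs.\<close>

lemma exists_connection_set:
  fixes h :: nat
  assumes "prime p" "s > 0" "p * (p - 1) \<le> 2 * h * s"
  shows "\<exists>B :: int set. B \<subseteq> {int h..<3 * int h} \<and> p \<le> card B + s \<and>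
    (\<forall>\<gamma>. \<gamma> \<noteq> 0 \<longrightarrow> card {x \<in> B \<union> uminus ` B. x - \<gamma> \<in> B \<union> uminus ` B} \<le> 4 * s)"
proof -
  obtain A0 where A0: "A0 \<subseteq> {..<p * (p - 1)}" "card A0 = p - 1" "sidon A0"
    using exists_sidon[OF assms(1)] by blast
  have fin0: "finite A0" using A0(1) by (rule finite_subset) simp
  obtain A where A: "A \<subseteq> A0" "inj_on (\<lambda>a. a div s) A" "card A0 \<le> card A + (s - 1)"
    using sidon_div_inj_subset[OF fin0 A0(3) assms(2)] by blast
  have fin: "finite A" using A(1) fin0 by (rule finite_subset)
  have sidon: "sidon A" using A0(3) A(1) by (rule sidon_subset)
  define C where "C = (\<lambda>a. int (a div s)) ` A"
  define B where "B = (\<lambda>c. int h + c) ` C"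
  have finB: "finite B" using fin by (simp add: B_def C_def)
  have C: "c \<in> {0..<2 * int h}" if "c \<in> C" for c
  proof -
    from that obtain a where a: "a \<in> A" "c = int (a div s)" by (auto simp: C_def)
    then have "a < 2 * h * s" using A(1) A0(1) assms(3) by fastforce
    then have "a div s < 2 * h" by (simp add: less_mult_imp_div_less)
    with a show ?thesis by simp
  qed
  have B: "b \<in> {int h..<3 * int h}" if "b \<in> B" for b
    using that C by (fastforce simp: B_def)
  have memB: "b \<in> B \<longleftrightarrow> b - h \<in> C" for b
    by (force simp: B_def)
  have "inj_on (\<lambda>a. int (a div s)) A"
    using A(2) by (simp add: inj_on_def)
  then have "card C = card A" by (simp add: C_def card_image)
  moreover have "card B = card C" unfolding B_def by (intro card_image) (simp add: inj_on_def)
  moreover have "p \<ge> 2" using assms(1) by (rule prime_ge_2_nat)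
  \<comment> \<open>One is lost because the Sidon set has p - 1 elements, and at most s - 1 more are
    lost to rounding.\<close>
  ultimately have cardB: "p \<le> card B + s"
    using A(3) A0(2) assms(2) by linarith
  have diff: "card {b \<in> B. b - \<gamma> \<in> B} \<le> 2 * s - 1" if "\<gamma> \<noteq> 0" for \<gamma>
  proof -
    have "{b \<in> B. b - \<gamma> \<in> B} = (\<lambda>c. int h + c) ` {c \<in> C. c - \<gamma> \<in> C}"
      by (force simp: memB algebra_simps)
    then have "card {b \<in> B. b - \<gamma> \<in> B} \<le> card {c \<in> C. c - \<gamma> \<in> C}"
      using fin by (simp add: card_image_le C_def)
    also have "\<dots> \<le> 2 * s - 1"
      unfolding C_def by (intro card_div_differences sidon fin assms A that)
    finally show ?thesis .
  qed
  have sum: "card {b \<in> B. \<gamma> - b \<in> B} \<le> 2 * (2 * s - 1)" for \<gamma>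
  proof -
    have "{b \<in> B. \<gamma> - b \<in> B} = (\<lambda>c. int h + c) ` {c \<in> C. (\<gamma> - 2 * h) - c \<in> C}"
      by (force simp: memB algebra_simps)
    then have "card {b \<in> B. \<gamma> - b \<in> B} \<le> card {c \<in> C. (\<gamma> - 2 * h) - c \<in> C}"
      using fin by (simp add: card_image_le C_def)
    also have "\<dots> \<le> 2 * (2 * s - 1)"
      unfolding C_def by (intro card_div_sums sidon fin assms)
    finally show ?thesis .
  qed
  have "card {x \<in> B \<union> uminus ` B. x - \<gamma> \<in> B \<union> uminus ` B} \<le> 4 * s" (is "card ?X \<le> _")
    if "\<gamma> \<noteq> 0" for \<gamma>
  proof -
    \<comment> \<open>Equal signs of \<open>x\<close> and \<open>x - \<gamma>\<close> give a
      difference of elements of \<open>B\<close>; opposite signs give a sum equal to \<gamma> or to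
      -\<gamma>.\<close>
    have X_cases: "(x \<in> B \<Longrightarrow> x - \<gamma> \<in> B \<Longrightarrow> Q) \<Longrightarrow> (- x \<in> B \<Longrightarrow> \<gamma> - x \<in> B \<Longrightarrow> Q)
      \<Longrightarrow> (x \<in> B \<Longrightarrow> \<gamma> - x \<in> B \<Longrightarrow> Q) \<Longrightarrow> (- x \<in> B \<Longrightarrow> x - \<gamma> \<in> B \<Longrightarrow> Q) \<Longrightarrow> Q"
      if "x \<in> ?X" for x Q
    proof -
      have *: "y \<in> B \<union> uminus ` B \<longleftrightarrow> y \<in> B \<or> - y \<in> B" for y
        by (auto intro: image_eqI[of _ _ "- y"])
      from that show "(x \<in> B \<Longrightarrow> x - \<gamma> \<in> B \<Longrightarrow> Q) \<Longrightarrow> (- x \<in> B \<Longrightarrow> \<gamma> - x \<in> B \<Longrightarrow> Q)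
        \<Longrightarrow> (x \<in> B \<Longrightarrow> \<gamma> - x \<in> B \<Longrightarrow> Q) \<Longrightarrow> (- x \<in> B \<Longrightarrow> x - \<gamma> \<in> B \<Longrightarrow> Q) \<Longrightarrow> Q"
        unfolding mem_Collect_eq * minus_diff_eq by blast
    qed
    \<comment> \<open>Small \<gamma> leaves differences only, for \<gamma> and -\<gamma>, with 2s -
      1 solutions each. Large \<gamma> leaves sums of a single sign, with at most 2(2s - 1)
      solutions. Either way the count is at most 4s - 2.\<close>
    consider "\<bar>\<gamma>\<bar> < 2 * int h" | "\<gamma> \<ge> 2 * int h" | "\<gamma> \<le> - 2 * int h" by linarith
    then show ?thesis
    proof cases
      case 1
      have "?X \<subseteq> {b \<in> B. b - \<gamma> \<in> B} \<union> uminus ` {b \<in> B. b - (- \<gamma>) \<in> B}"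
      proof
        fix x assume x: "x \<in> ?X"
        then consider "x \<in> B" "x - \<gamma> \<in> B" | "- x \<in> B" "\<gamma> - x \<in> B"
          | "x \<in> B" "\<gamma> - x \<in> B" | "- x \<in> B" "x - \<gamma> \<in> B"
          by (elim X_cases)
        then show "x \<in> {b \<in> B. b - \<gamma> \<in> B} \<union> uminus ` {b \<in> B. b - (- \<gamma>) \<in> B}"
        proof cases
          case 1 then show ?thesis by simp
        next
          case 2 then show ?thesis by (intro UnI2 image_eqI[of _ _ "- x"]) (auto simp: algebra_simps)
        next
          case 3 then show ?thesis using B[of x] B[of "\<gamma> - x"] \<open>\<bar>\<gamma>\<bar> < 2 * int h\<close> by auto
        next
          case 4 then show ?thesis using B[of "- x"] B[of "x - \<gamma>"] \<open>\<bar>\<gamma>\<bar> < 2 * int h\<close> by auto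
        qed
      qed
      then have "card ?X \<le> card ({b \<in> B. b - \<gamma> \<in> B} \<union> uminus ` {b \<in> B. b - (- \<gamma>) \<in> B})"
        using finB by (intro card_mono) auto
      also have "\<dots> \<le> card {b \<in> B. b - \<gamma> \<in> B} + card (uminus ` {b \<in> B. b - (- \<gamma>) \<in> B})"
        by (rule card_Un_le)
      also have "card (uminus ` {b \<in> B. b - (- \<gamma>) \<in> B}) \<le> card {b \<in> B. b - (- \<gamma>) \<in> B}"
        using finB by (intro card_image_le) simp
      finally show ?thesis
        using diff[of \<gamma>] diff[of "- \<gamma>"] that by simp
    next
      case 2
      have "?X \<subseteq> {b \<in> B. \<gamma> - b \<in> B}"
      proof
        fix x assume x: "x \<in> ?X"
        then consider "x \<in> B" "x - \<gamma> \<in> B" | "- x \<in> B" "\<gamma> - x \<in> B"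
          | "x \<in> B" "\<gamma> - x \<in> B" | "- x \<in> B" "x - \<gamma> \<in> B"
          by (elim X_cases)
        then show "x \<in> {b \<in> B. \<gamma> - b \<in> B}"
          using 2 by cases (auto dest!: B)
      qed
      then have "card ?X \<le> card {b \<in> B. \<gamma> - b \<in> B}"
        using finB by (intro card_mono) auto
      with sum[of \<gamma>] show ?thesis by simp
    next
      case 3
      have "?X \<subseteq> uminus ` {b \<in> B. - \<gamma> - b \<in> B}"
      proof
        fix x assume x: "x \<in> ?X"
        then consider "x \<in> B" "x - \<gamma> \<in> B" | "- x \<in> B" "\<gamma> - x \<in> B"
          | "x \<in> B" "\<gamma> - x \<in> B" | "- x \<in> B" "x - \<gamma> \<in> B"
          by (elim X_cases)
        then have "- x \<in> {b \<in> B. - \<gamma> - b \<in> B}"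
          using 3 by cases (auto dest!: B simp: algebra_simps)
        then show "x \<in> uminus ` {b \<in> B. - \<gamma> - b \<in> B}"
          by (intro image_eqI[of _ _ "- x"]) simp_all
      qed
      then have "card ?X \<le> card (uminus ` {b \<in> B. - \<gamma> - b \<in> B})"
        using finB by (intro card_mono) auto
      also have "\<dots> \<le> card {b \<in> B. - \<gamma> - b \<in> B}"
        using finB by (intro card_image_le) simp
      finally show ?thesis using sum[of "- \<gamma>"] by simp
    qed
  qed
  moreover have "B \<subseteq> {int h..<3 * int h}" using B by auto
  ultimately show ?thesis using cardB by blast
qed

section \<open>Circulant graphs\<close>

definition circulant :: "nat \<Rightarrow> int set \<Rightarrow> nat pair_pre_digraph" where
  "circulant n S =
     \<lparr> pverts = {..<n}, parcs = {(u, v). u < n \<and> v < n \<and> (\<exists>x\<in>S. [int v = int u + x] (mod int n))} \<rparr>"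

lemma pverts_circulant [simp]: "pverts (circulant n S) = {..<n}"
  by (simp add: circulant_def)

lemma parcs_circulant:
  "(u, v) \<in> parcs (circulant n S) \<longleftrightarrow> u < n \<and> v < n \<and> (\<exists>x\<in>S. [int v = int u + x] (mod int n))"
  by (simp add: circulant_def)

lemma cong_abs_less_imp_eq:
  fixes x y m :: int
  assumes "[x = y] (mod m)" "\<bar>x - y\<bar> < m"
  shows "x = y"
proof -
  have "m dvd \<bar>x - y\<bar>"
    using assms(1) by (simp add: cong_iff_dvd_diff)
  then show ?thesis
    using zdvd_not_zless[of "\<bar>x - y\<bar>" m] assms(2) by (cases "x = y") auto
qed

text \<open>Positivity separates \<open>B\<close> from its negative. The bound n/4 makes any
  combination of up to four elements of \<open>S\<close> with signs smaller than n in absolute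
  value, so congruences between differences are integer equalities.\<close>

locale connection_set =
  fixes n :: nat and B S :: "int set"
  assumes B: "B \<subseteq> {0<..}" and B_small: "\<And>b. b \<in> B \<Longrightarrow> 4 * b < int n"
  defines "S \<equiv> B \<union> uminus ` B"
begin

lemma S_bounds:
  assumes "x \<in> S"
  shows "x \<noteq> 0" and "4 * \<bar>x\<bar> < int n"
  using assms B B_small by (force simp: S_def)+

lemma uminus_in_S: "x \<in> S \<Longrightarrow> - x \<in> S"
  by (auto simp: S_def)

lemma finite_B: "finite B"
  using B B_small by (intro finite_subset[of B "{0..int n}"]) force+

lemma S_cong_unique:
  assumes "x \<in> S" "y \<in> S" "[x = y] (mod int n)"
  shows "x = y"
  using assms(3) by (rule cong_abs_less_imp_eq) (use S_bounds[OF assms(1)] S_bounds[OF assms(2)] in linarith)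

definition shift :: "nat \<Rightarrow> int \<Rightarrow> nat" where
  "shift u x = nat ((int u + x) mod int n)"

lemma shift_less: "n > 0 \<Longrightarrow> shift u x < n"
  by (simp add: shift_def nat_less_iff)

lemma int_shift: "n > 0 \<Longrightarrow> int (shift u x) = (int u + x) mod int n"
  by (simp add: shift_def)

lemma cong_iff_shift: "v < n \<Longrightarrow> [int v = int u + x] (mod int n) \<longleftrightarrow> v = shift u x"
  by (auto simp: shift_def Cong.cong_def)

lemma shift_cong: "n > 0 \<Longrightarrow> [int (shift u x) = int u + x] (mod int n)"
  by (simp add: int_shift Cong.cong_def)

lemma pair_graph_circulant: "pair_graph (circulant n S)"
proof
  show "finite (parcs (circulant n S))"
    by (rule finite_subset[of _ "{..<n} \<times> {..<n}"]) (auto simp: circulant_def)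
  show "symmetric (circulant n S)"
    unfolding symmetric_def with_proj_simps
  proof (rule symI)
    fix u v assume "(u, v) \<in> parcs (circulant n S)"
    then obtain x where "u < n" "v < n" "x \<in> S" "[int v = int u + x] (mod int n)"
      by (auto simp: parcs_circulant)
    then have "[int u = int v + - x] (mod int n)"
      by (simp add: cong_iff_dvd_diff dvd_diff_commute algebra_simps)
    with \<open>u < n\<close> \<open>v < n\<close> \<open>x \<in> S\<close> show "(v, u) \<in> parcs (circulant n S)"
      unfolding parcs_circulant by (blast intro: uminus_in_S)
  qed
  fix e assume e: "e \<in> parcs (circulant n S)"
  then show "fst e \<in> pverts (circulant n S)" "snd e \<in> pverts (circulant n S)"
    by (auto simp: circulant_def)
  show "fst e \<noteq> snd e"
  proof
    assume "fst e = snd e"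
    with e obtain x where "x \<in> S" "[int (fst e) = int (fst e) + x] (mod int n)"
      by (cases e) (auto simp: parcs_circulant)
    then have "[x = 0] (mod int n)"
      by (metis add.right_neutral cong_add_lcancel cong_sym)
    then have "x = 0"
      by (rule cong_abs_less_imp_eq) (use S_bounds[OF \<open>x \<in> S\<close>] in linarith)
    with S_bounds[OF \<open>x \<in> S\<close>] show False by simp
  qed
qed simp_all

lemma regular_graph_circulant: "regular_graph (circulant n S)"
  unfolding regular_graph_def
proof (intro conjI exI ballI)
  fix u assume "u \<in> pverts (circulant n S)"
  then have u: "u < n" and n: "n > 0" by auto
  have "out_arcs (circulant n S) u = (\<lambda>x. (u, shift u x)) ` S"
    using u n by (auto simp: out_arcs_def parcs_circulant cong_iff_shift shift_less)
  moreover have "inj_on (\<lambda>x. (u, shift u x)) S"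
  proof (rule inj_onI)
    fix x y assume S: "x \<in> S" "y \<in> S" and "(u, shift u x) = (u, shift u y)"
    then have "(int u + x) mod int n = (int u + y) mod int n"
      using n by (simp flip: int_shift)
    then have "[int u + x = int u + y] (mod int n)"
      by (simp only: Cong.cong_def)
    then have "[x = y] (mod int n)"
      by (simp only: cong_add_lcancel)
    with S show "x = y" by (intro S_cong_unique)
  qed
  ultimately show "out_degree (circulant n S) u = card S"
    by (simp add: out_degree_def card_image)
qed (rule pair_graph_circulant)

text \<open>Each edge has a unique representation \<open>{u, u + b}\<close> with \<open>b \<in> B\<close>.\<close>

lemma card_edge_set_circulant: "n * card B \<le> card (edge_set (circulant n S))"
proof -
  have "inj_on (\<lambda>(u, b). {u, shift u b}) ({..<n} \<times> B)"
  proof (rule inj_onI, clarify)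
    fix u b u' b'
    assume u: "u < n" "u' < n" and b: "b \<in> B" "b' \<in> B" and eq: "{u, shift u b} = {u', shift u' b'}"
    have S: "b \<in> S" "b' \<in> S" using b by (auto simp: S_def)
    have c: "[int (shift u b) = int u + b] (mod int n)" "[int (shift u' b') = int u' + b'] (mod int n)"
      using u by (auto intro: shift_cong)
    from eq consider "u = u'" "shift u b = shift u' b'" | "u = shift u' b'" "u' = shift u b"
      by (auto simp: doubleton_eq_iff)
    then show "u = u' \<and> b = b'"
    proof cases
      case 1
      then have "[int u + b = int u + b'] (mod int n)"
        using c by (metis cong_sym cong_trans)
      then have "[b = b'] (mod int n)"
        by (simp only: cong_add_lcancel)
      then show ?thesis
        using 1 S S_cong_unique by blast
    next
      case 2
      \<comment> \<open>An edge represented from both ends would give b = -b' modulo n, hence as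
        integers, against positivity.\<close>
      then have "int n dvd (int u' - (int u + b)) + (int u - (int u' + b'))"
        using c by (intro dvd_add) (simp_all add: cong_iff_dvd_diff)
      then have "[b = - b'] (mod int n)"
        by (simp add: cong_iff_dvd_diff dvd_diff_commute algebra_simps)
      then have "b = - b'"
        using S by (intro S_cong_unique uminus_in_S)
      moreover have "b > 0" "b' > 0"
        using b B by auto
      ultimately show ?thesis
        by simp
    qed
  qed
  then have "n * card B = card ((\<lambda>(u, b). {u, shift u b}) ` ({..<n} \<times> B))"
    by (simp add: card_image card_cartesian_product)
  also have "\<dots> \<le> card (edge_set (circulant n S))"
  proof (rule card_mono)
    have "edge_set (circulant n S) \<subseteq> Pow {..<n}"
      by (auto simp: edge_set_def parcs_circulant)
    then show "finite (edge_set (circulant n S))"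
      by (rule finite_subset) simp
    show "(\<lambda>(u, b). {u, shift u b}) ` ({..<n} \<times> B) \<subseteq> edge_set (circulant n S)"
    proof (rule image_subsetI, clarify)
      fix u b assume "u < n" "b \<in> B"
      then have "(u, shift u b) \<in> parcs (circulant n S)"
        by (auto simp: parcs_circulant S_def shift_less cong_iff_shift)
      then show "{u, shift u b} \<in> edge_set (circulant n S)"
        by (auto simp: edge_set_def)
    qed
  qed
  finally show ?thesis .
qed

text \<open>A common neighbour w is u + x = v + y modulo n with x, y in \<open>S\<close>, so x - y
  is congruent to v - u. By the n/4 bound this difference is the same integer \<gamma> for all w,
  nonzero since u and v differ, and x determines w.\<close>

lemma common_neighbours_circulant:
  assumes W: "W \<subseteq> {w. (u, w) \<in> parcs (circulant n S) \<and> (v, w) \<in> parcs (circulant n S)}" and "u \<noteq> v"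
    and bound: "\<And>\<gamma>. \<gamma> \<noteq> 0 \<Longrightarrow> card {x \<in> S. x - \<gamma> \<in> S} \<le> k"
  shows "card W \<le> k"
proof (cases "W = {}")
  case False
  have "\<exists>x y. x \<in> S \<and> y \<in> S \<and> [int w = int u + x] (mod int n) \<and> [int w = int v + y] (mod int n)
    \<and> u < n \<and> v < n \<and> w < n" if "w \<in> W" for w
    using subsetD[OF W that] unfolding mem_Collect_eq parcs_circulant by blast
  then obtain f g where fg: "\<And>w. w \<in> W \<Longrightarrow> f w \<in> S" "\<And>w. w \<in> W \<Longrightarrow> g w \<in> S"
    "\<And>w. w \<in> W \<Longrightarrow> [int w = int u + f w] (mod int n)"
    "\<And>w. w \<in> W \<Longrightarrow> [int w = int v + g w] (mod int n)"
    and less: "\<And>w. w \<in> W \<Longrightarrow> u < n \<and> v < n \<and> w < n"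
    by metis
  have diff: "[f w - g w = int v - int u] (mod int n)" if "w \<in> W" for w
  proof -
    have "int n dvd (int w - (int v + g w)) - (int w - (int u + f w))"
      using fg(4)[OF that] fg(3)[OF that] unfolding cong_iff_dvd_diff by (rule dvd_diff)
    then show ?thesis
      by (simp add: cong_iff_dvd_diff algebra_simps)
  qed
  obtain w0 where w0: "w0 \<in> W" using False by blast
  define \<gamma> where "\<gamma> = f w0 - g w0"
  have "\<gamma> \<noteq> 0"
  proof
    assume "\<gamma> = 0"
    then have "[int v = int u] (mod int n)"
      using diff[OF w0] by (simp add: \<gamma>_def cong_iff_dvd_diff dvd_diff_commute)
    then have "int v = int u"
      by (rule cong_abs_less_imp_eq) (use less[OF w0] in linarith)
    with \<open>u \<noteq> v\<close> show False by simp
  qed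
  have eq: "f w - g w = \<gamma>" if "w \<in> W" for w
  proof (rule cong_abs_less_imp_eq)
    show "[f w - g w = \<gamma>] (mod int n)"
      using diff[OF that] diff[OF w0] unfolding \<gamma>_def by (metis cong_sym cong_trans)
    show "\<bar>f w - g w - \<gamma>\<bar> < int n"
      using S_bounds(2)[OF fg(1)[OF that]] S_bounds(2)[OF fg(2)[OF that]]
        S_bounds(2)[OF fg(1)[OF w0]] S_bounds(2)[OF fg(2)[OF w0]]
      unfolding \<gamma>_def by linarith
  qed
  have "card W \<le> card {x \<in> S. x - \<gamma> \<in> S}"
  proof (rule card_inj_on_le)
    show "inj_on f W"
    proof (rule inj_onI)
      fix w w' assume w: "w \<in> W" "w' \<in> W" "f w = f w'"
      then have "[int w = int w'] (mod int n)"
        using fg(3)[OF w(1)] fg(3)[OF w(2)] by (metis cong_sym cong_trans)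
      then have "int w = int w'"
        by (rule cong_abs_less_imp_eq) (use less[OF w(1)] less[OF w(2)] in linarith)
      then show "w = w'" by simp
    qed
    show "f ` W \<subseteq> {x \<in> S. x - \<gamma> \<in> S}"
    proof (rule image_subsetI)
      fix w assume w: "w \<in> W"
      then have "f w - \<gamma> = g w" using eq by force
      with fg w show "f w \<in> {x \<in> S. x - \<gamma> \<in> S}" by simp
    qed
    show "finite {x \<in> S. x - \<gamma> \<in> S}"
      using finite_B by (simp add: S_def)
  qed
  with bound[OF \<open>\<gamma> \<noteq> 0\<close>] show ?thesis by simp
qed simp

end

lemma contains_complete_bipartite_2D:
  assumes "contains_graph G (complete_bipartite 2 k)"
  obtains u v W where "u \<noteq> v" "card W = k" "\<And>w. w \<in> W \<Longrightarrow> (u, w) \<in> parcs G \<and> (v, w) \<in> parcs G"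
proof -
  let ?K = "complete_bipartite 2 k"
  obtain H where sub: "subgraph (with_proj H) (with_proj G)"
    and iso: "digraph_iso (with_proj H) (with_proj ?K)"
    using assms by (auto simp: contains_graph_def)
  have parcs: "parcs H \<subseteq> parcs G" using sub by (auto simp: subgraph_def)
  obtain f where f: "pre_digraph.digraph_isomorphism (with_proj H) f"
    and K: "with_proj ?K = app_iso f (with_proj H)"
    using iso by (auto simp: digraph_iso_def)
  define \<phi> where "\<phi> = iso_verts f"
  have verts: "\<phi> ` pverts H = pverts ?K"
    using arg_cong[OF K, of verts] by (simp add: \<phi>_def)
  have arc: "\<exists>u w. (u, w) \<in> parcs H \<and> \<phi> u = a \<and> \<phi> w = b" if "(a, b) \<in> parcs ?K" for a b
  proof -
    have "(a, b) \<in> iso_arcs f ` parcs H"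
      using that arg_cong[OF K, of arcs] by simp
    then obtain u w where uw: "(u, w) \<in> parcs H" "(a, b) = iso_arcs f (u, w)" by auto
    \<comment> \<open>An isomorphism record carries the tail and head maps of its image; since the
      image is a pair digraph, they must be the projections, so the arc map acts through the vertex
      map.\<close>
    have "iso_tail f = fst" "iso_head f = snd"
      using arg_cong[OF K, of tail] arg_cong[OF K, of head] by simp_all
    then have "\<phi> u = a" "\<phi> w = b"
      using f uw unfolding pre_digraph.digraph_isomorphism_def
      by (metis \<phi>_def fst_conv snd_conv with_proj_simps(2,4,5))+
    with uw show ?thesis by blast
  qed
  have inj: "inj_on \<phi> (pverts H)"
    using f by (simp add: pre_digraph.digraph_isomorphism_def \<phi>_def)
  have wf: "u \<in> pverts H \<and> w \<in> pverts H" if "(u, w) \<in> parcs H" for u w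
    using sub that by (auto simp: subgraph_def dest: wf_digraph.tail_in_verts wf_digraph.head_in_verts)
  define \<psi> where "\<psi> = inv_into (pverts H) \<phi>"
  have psi: "\<psi> (\<phi> u) = u" if "u \<in> pverts H" for u
    using inj that by (simp add: \<psi>_def)
  have psi_arc: "(\<psi> a, \<psi> b) \<in> parcs G" if ab: "(a, b) \<in> parcs ?K" for a b
  proof -
    obtain u w where uw: "(u, w) \<in> parcs H" "\<phi> u = a" "\<phi> w = b"
      using arc[OF ab] by blast
    then have "\<psi> a = u" "\<psi> b = w"
      using wf[OF uw(1)] psi by auto
    with uw(1) parcs show ?thesis by auto
  qed
  have inj_psi: "inj_on \<psi> (pverts ?K)"
    unfolding \<psi>_def verts[symmetric] by (rule inj_on_inv_into) simp
  show ?thesis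
  proof
    have K_verts: "Inl 0 \<in> pverts ?K" "Inl 1 \<in> pverts ?K" "Inr ` {..<k} \<subseteq> pverts ?K"
      by (auto simp: complete_bipartite_def Let_def)
    show "\<psi> (Inl 0) \<noteq> \<psi> (Inl 1)"
      using inj_onD[OF inj_psi _ K_verts(1,2)] by auto
    have "card (\<psi> ` Inr ` {..<k}) = card (Inr ` {..<k} :: (nat + nat) set)"
      using inj_psi K_verts(3) by (intro card_image) (rule inj_on_subset)
    then show "card (\<psi> ` Inr ` {..<k}) = k"
      by (simp add: card_image)
    show "(\<psi> (Inl 0), w) \<in> parcs G \<and> (\<psi> (Inl 1), w) \<in> parcs G" if "w \<in> \<psi> ` Inr ` {..<k}" for w
      using that psi_arc by (auto simp: complete_bipartite_def Let_def)
  qed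
qed

section \<open>The lower bound\<close>

lemma rex_complete_bipartite_ge:
  assumes "prime p" "s > 0" "p * (p - 1) \<le> 2 * (n div 12) * s"
  shows "n * (p - s) \<le> rex n (complete_bipartite 2 (4 * s + 1))"
proof -
  \<comment> \<open>Elements of the connection set lie below 3h, and the locale demands 4b < n; this
    is where 12 comes from.\<close>
  define h where "h = n div 12"
  have "p * (p - 1) \<le> 2 * h * s"
    using assms(3) by (simp add: h_def)
  then obtain B :: "int set" where B_sub: "B \<subseteq> {int h..<3 * int h}" and B_card: "p \<le> card B + s"
    and count: "\<And>\<gamma>. \<gamma> \<noteq> 0 \<Longrightarrow> card {x \<in> B \<union> uminus ` B. x - \<gamma> \<in> B \<union> uminus ` B} \<le> 4 * s"
    using exists_connection_set[OF assms(1,2)] by blast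
  have "p * (p - 1) > 0"
    using prime_ge_2_nat[OF assms(1)] by simp
  then have "h > 0"
    using assms(3) by (auto simp: h_def intro!: Nat.gr0I)
  have "12 * h \<le> n"
    by (simp add: h_def)
  define S where "S = B \<union> uminus ` B"
  interpret connection_set n B S
  proof unfold_locales
    show "B \<subseteq> {0<..}"
      using B_sub \<open>h > 0\<close> by force
    show "4 * b < int n" if "b \<in> B" for b
      using that B_sub \<open>12 * h \<le> n\<close> by fastforce
  qed (simp add: S_def)
  let ?G = "circulant n S"
  have "\<not> contains_graph ?G (complete_bipartite 2 (4 * s + 1))"
  proof
    assume "contains_graph ?G (complete_bipartite 2 (4 * s + 1))"
    then obtain u v W where uv: "u \<noteq> v" and W: "card W = 4 * s + 1"
      and "\<And>w. w \<in> W \<Longrightarrow> (u, w) \<in> parcs ?G \<and> (v, w) \<in> parcs ?G"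
      by (rule contains_complete_bipartite_2D) blast
    then have "card W \<le> 4 * s"
      using count by (intro common_neighbours_circulant[of W u v]) (auto simp: S_def)
    with W show False by simp
  qed
  then have "card (edge_set ?G) \<in> rex_counts n (complete_bipartite 2 (4 * s + 1))"
    using regular_graph_circulant by (auto simp: rex_counts_def)
  then have "card (edge_set ?G) \<le> rex n (complete_bipartite 2 (4 * s + 1))"
    unfolding rex_def by (intro Max_ge finite_rex_counts)
  moreover have "n * (p - s) \<le> n * card B"
    using B_card by (intro mult_le_mono2) simp
  ultimately show ?thesis
    using card_edge_set_circulant by linarith
qed

text \<open>This holds because \<open>(4/5)\<^sup>2 / 12 > 1/20\<close>; the factor \<open>4/5\<close> is the loss from primes in \<open>(24m, 30m]\<close>.\<close>

lemma eventually_sqrt_bound: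
  fixes C :: real
  shows "\<forall>\<^sub>F n in sequentially. sqrt (1 / 20) * sqrt (real n) + C \<le> 4 / 5 * sqrt (real n / 12 - 1)"
proof -
  \<comment> \<open>The constants fit since 0.224^2 > 1/20, (9/32)^2 = 81/1024 < 1/12 and
    (4/5)(9/32) = 0.225. The gap of 1/1000 between 0.225 and 0.224 absorbs \<open>C\<close>.\<close>
  have sqrt20: "sqrt (1 / 20) \<le> (224 / 1000 :: real)"
    by (rule real_le_lsqrt) (simp_all add: power2_eq_square)
  have "\<forall>\<^sub>F n in sequentially. C \<le> 1 / 1000 * sqrt (real n)"
    by real_asymp
  moreover have "\<forall>\<^sub>F n in sequentially. 81 / 1024 * real n \<le> real n / 12 - 1"
    by real_asymp
  ultimately show ?thesis
  proof eventually_elim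
    case (elim n)
    have "sqrt ((9 / 32)\<^sup>2 * real n) \<le> sqrt (real n / 12 - 1)"
      using elim(2) by (intro real_sqrt_le_mono) (simp add: power2_eq_square)
    then have "225 / 1000 * sqrt (real n) \<le> 4 / 5 * sqrt (real n / 12 - 1)"
      by (simp add: real_sqrt_mult)
    moreover have "sqrt (1 / 20) * sqrt (real n) \<le> 224 / 1000 * sqrt (real n)"
      using sqrt20 by (intro mult_right_mono) simp_all
    ultimately show ?case
      using elim(1) by linarith
  qed
qed

theorem theorem1p2:
  fixes t :: nat
  assumes "t \<ge> 1" and "even t"
  shows "\<exists>\<epsilon> :: nat \<Rightarrow> real. \<epsilon> \<in> o(\<lambda>_. 1) \<and>
    (\<forall>\<^sub>F n in sequentially.
       real (rex n (complete_bipartite 2 (2 * t + 1)))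
         \<ge> (sqrt (real t / 20) - \<epsilon> n) * real n powr (3 / 2))"
proof -
  obtain s where s: "t = 2 * s" "s > 0"
    using assms by (auto elim: evenE)
  obtain M where M: "\<And>m. m \<ge> M \<Longrightarrow> \<exists>p. prime p \<and> 24 * m < p \<and> p \<le> (30 * m :: nat)"
    using eventually_prime_between_24_30 by (auto simp: eventually_sequentially)
  have t: "real t > 0" using assms by simp
  have "\<forall>\<^sub>F n in sequentially. real M \<le> sqrt (real t * (real n / 12 - 1)) / 30"
    using t by real_asymp
  \<comment> \<open>After multiplication by sqrt t the additive term is 24 + s: 24 for the floor in
    \<open>m\<close>, as p > 24m, and s for the elements missing from the connection set.\<close>
  moreover have "\<forall>\<^sub>F n in sequentially. sqrt (1 / 20) * sqrt (real n) + (24 + real s) / sqrt t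
      \<le> 4 / 5 * sqrt (real n / 12 - 1)"
    by (rule eventually_sqrt_bound)
  ultimately have "\<forall>\<^sub>F n in sequentially. real (rex n (complete_bipartite 2 (2 * t + 1)))
      \<ge> sqrt (real t / 20) * real n powr (3 / 2)"
  proof eventually_elim
    case (elim n)
    define h where "h = n div 12"
    \<comment> \<open>This choice makes 30m at most sqrt(th), so a prime p <= 30m satisfies p^2 <=
      th = 2hs.\<close>
    define m where "m = nat \<lfloor>sqrt (real (t * h)) / 30\<rfloor>"
    have h: "real n / 12 - 1 \<le> real h"
      unfolding h_def by linarith
    then have sqrt_h: "sqrt (real t * (real n / 12 - 1)) \<le> sqrt (real (t * h))"
      using t by (simp add: mult_left_mono)
    with elim(1) have "real M \<le> sqrt (real (t * h)) / 30"
      by linarith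
    then have "m \<ge> M"
      by (simp add: m_def le_nat_floor)
    then obtain p where p: "prime p" "24 * m < p" "p \<le> 30 * m"
      using M by blast
    have "real m = of_int \<lfloor>sqrt (real (t * h)) / 30\<rfloor>"
      by (simp add: m_def)
    then have m_le: "real m \<le> sqrt (real (t * h)) / 30" and m_ge: "real m \<ge> sqrt (real (t * h)) / 30 - 1"
      by linarith+
    have "real p \<le> real (30 * m)"
      using p(3) by (simp only: of_nat_le_iff)
    then have "real p \<le> sqrt (real (t * h))"
      using m_le by simp
    then have "real p ^ 2 \<le> sqrt (real (t * h)) ^ 2"
      by (intro power_mono) simp_all
    then have "real (p ^ 2) \<le> real (t * h)"
      by simp
    then have "p ^ 2 \<le> t * h"
      by (simp only: of_nat_le_iff)
    moreover have "p * (p - 1) \<le> p ^ 2"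
      by (simp add: power2_eq_square)
    ultimately have "p * (p - 1) \<le> 2 * (n div 12) * s"
      using s(1) by (simp add: h_def mult_ac)
    then have rex: "n * (p - s) \<le> rex n (complete_bipartite 2 (2 * t + 1))"
      using rex_complete_bipartite_ge[OF p(1) s(2)] s(1) by simp
    have cancel: "sqrt t * (x + y / sqrt t) = sqrt t * x + y" for x y :: real
      using t by (simp add: distrib_left)
    have "sqrt t * (sqrt (1 / 20) * sqrt n + (24 + real s) / sqrt t) \<le> sqrt t * (4 / 5 * sqrt (real n / 12 - 1))"
      using elim(2) by (intro mult_left_mono) simp_all
    also have "\<dots> = 4 / 5 * sqrt (real t * (real n / 12 - 1))"
      by (simp add: real_sqrt_mult)
    also have "\<dots> \<le> 4 / 5 * sqrt (real (t * h))"
      using sqrt_h by simp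
    finally have "sqrt t * sqrt (1 / 20) * sqrt n + (24 + real s) \<le> 4 / 5 * sqrt (real (t * h))"
      unfolding cancel by (simp only: mult.assoc)
    moreover have "real p > 24 * real m"
      using p(2) by linarith
    ultimately have "sqrt t * sqrt (1 / 20) * sqrt n \<le> real p - real s"
      using m_ge by linarith
    moreover have "sqrt (real t / 20) = sqrt t * sqrt (1 / 20)"
      by (simp flip: real_sqrt_mult)
    ultimately have main: "sqrt (real t / 20) * sqrt n \<le> real p - real s"
      by (simp only:)
    have "real n powr (3 / 2) = real n * sqrt n"
      using powr_add[of "real n" 1 "1 / 2"] by (simp add: powr_half_sqrt)
    then have "sqrt (real t / 20) * real n powr (3 / 2) = real n * (sqrt (real t / 20) * sqrt n)"
      by simp
    \<comment> \<open>Truncated subtraction is harmless here, as it only increases the value when p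
      < s.\<close>
    also have "\<dots> \<le> real n * real (p - s)"
      using main by (intro mult_left_mono) linarith+
    also have "\<dots> \<le> real (rex n (complete_bipartite 2 (2 * t + 1)))"
      using rex by (simp flip: of_nat_mult)
    finally show ?case .
  qed
  then show ?thesis
    by (intro exI[of _ "\<lambda>_. 0"]) simp
qed

end
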